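(* Let $w=w_1\,dx+w_2\,dy\in\Omega^1(\mathbb H)$ be a differentiable $1$-form on the hyperbolic upper half-plane $\mathbb H$. Then the Hodge Laplacian satisfies $$ \begin{aligned} \triangle^1(w_1\,dx+w_2\,dy)={}&\left(-y^2\frac{\partial^2w_1}{\partial x^2}-y^2\frac{\partial^2w_1}{\partial y^2}+2y\frac{\partial w_2}{\partial x}-2y\frac{\partial w_1}{\partial y}\right)dx\\ &+\left(-y^2\frac{\partial^2w_2}{\partial x^2}-y^2\frac{\partial^2w_2}{\partial y^2}-2y\frac{\partial w_1}{\partial x}-2y\frac{\partial w_2}{\partial y}\right)dy. \end{aligned} $$
   Context: $\mathbb H=\{(x,y):y>0\}$ is equipped with the hyperbolic Riemannian metric $(dx^2+dy^2)/y^2$. $\Omega^1(\mathbb H)$ denotes the (smooth) differential $1$-forms on $\mathbb H$. $\triangle^1:\Omega^1(\mathbb H)\to\Omega^1(\mathbb H)$ is the Hodge Laplacian on $1$-forms, with the sign convention that it is a nonnegative operator ($\triangle^1=d\delta+\delta d$, equivalently, by the Weitzenböck formula, $\triangle^1w=\nabla^*\nabla w+\mathrm{Ric}(w^\#,\cdot)$ with $\nabla^*\nabla$ the Bochner Laplacian). *)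

theory Defs
  imports "HOL-Analysis.Analysis"
begin

text \<open>
  All forms live on open subsets of the oriented plane, with the frame \<open>(1, 0)\<close>, \<open>(0, 1)\<close>
  positively oriented. Fields are total functions; only their values on the open set under
  consideration carry meaning.
\<close>

type_synonym point = "real \<times> real"
type_synonym vec = "real \<times> real"
type_synonym covec = "vec \<Rightarrow> real"
type_synonym form0 = "point \<Rightarrow> real"
type_synonym form1 = "point \<Rightarrow> vec \<Rightarrow> real"
type_synonym form2 = "point \<Rightarrow> vec \<Rightarrow> vec \<Rightarrow> real"
type_synonym metric = "point \<Rightarrow> vec \<Rightarrow> vec \<Rightarrow> real"

text \<open>Intended for open \<open>S\<close>: the derivatives are taken in the ambient space.\<close>

primrec Ck_on :: "nat \<Rightarrow> 'a::euclidean_space set \<Rightarrow> ('a \<Rightarrow> real) \<Rightarrow> bool" where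
  "Ck_on 0 S f \<longleftrightarrow> continuous_on S f"
| "Ck_on (Suc k) S f \<longleftrightarrow>
     (\<forall>p\<in>S. f differentiable (at p)) \<and>
     (\<forall>v. Ck_on k S (\<lambda>p. frechet_derivative f (at p) v))"

definition smooth_on :: "'a::euclidean_space set \<Rightarrow> ('a \<Rightarrow> real) \<Rightarrow> bool" where
  "smooth_on S f \<longleftrightarrow> (\<forall>k. Ck_on k S f)"

definition Omega1 :: "point set \<Rightarrow> form1 set" where
  "Omega1 S = {w. (\<forall>p\<in>S. linear (w p)) \<and> (\<forall>v. smooth_on S (\<lambda>p. w p v))}"

definition dx :: covec where "dx v = fst v"

definition dy :: covec where "dy v = snd v"

definition ext_d0 :: "form0 \<Rightarrow> form1" where
  "ext_d0 f p v = frechet_derivative f (at p) v"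

text \<open>
  The invariant formula \<open>dw(U, V) = U(w(V)) - V(w(U)) - w([U, V])\<close> for constant vector
  fields \<open>U\<close> and \<open>V\<close>, whose bracket vanishes.
\<close>

definition ext_d1 :: "form1 \<Rightarrow> form2" where
  "ext_d1 w p u v =
     frechet_derivative (\<lambda>q. w q v) (at p) u - frechet_derivative (\<lambda>q. w q u) (at p) v"

definition wedge :: "covec \<Rightarrow> covec \<Rightarrow> vec \<Rightarrow> vec \<Rightarrow> real" where
  "wedge \<alpha> \<beta> u v = \<alpha> u * \<beta> v - \<alpha> v * \<beta> u"

definition vol :: "metric \<Rightarrow> form2" where
  "vol g p u v =
     sqrt (g p (1, 0) (1, 0) * g p (0, 1) (0, 1) - (g p (1, 0) (0, 1))\<^sup>2) * wedge dx dy u v"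

definition sharp :: "metric \<Rightarrow> point \<Rightarrow> covec \<Rightarrow> vec" where
  "sharp g p \<alpha> = (THE u. \<forall>v. g p u v = \<alpha> v)"

definition covec_inner :: "metric \<Rightarrow> point \<Rightarrow> covec \<Rightarrow> covec \<Rightarrow> real" where
  "covec_inner g p \<alpha> \<beta> = g p (sharp g p \<alpha>) (sharp g p \<beta>)"

text \<open>
  The star is determined by \<open>\<alpha> \<and> \<star>\<beta> = \<langle>\<alpha>, \<beta>\<rangle> vol\<close>. On 1-forms
  this is taken as the definition. On 0-forms it reads \<open>\<star>f = f vol\<close>; since \<open>vol\<close> has
  length 1, on 2-forms it reads \<open>\<star>(c vol) = c\<close>.
\<close>

definition star1 :: "metric \<Rightarrow> form1 \<Rightarrow> form1" where
  "star1 g w p = (THE \<gamma>. linear \<gamma> \<and>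
     (\<forall>\<alpha>. linear \<alpha> \<longrightarrow> wedge \<alpha> \<gamma> = (\<lambda>u v. covec_inner g p \<alpha> (w p) * vol g p u v)))"

definition star2 :: "metric \<Rightarrow> form2 \<Rightarrow> form0" where
  "star2 g \<eta> p = (THE c. \<eta> p = (\<lambda>u v. c * vol g p u v))"

text \<open>
  On \<open>k\<close>-forms in dimension \<open>n\<close> the formal adjoint of the exterior derivative is
  \<open>(-1)^(n * (k + 1) + 1) \<star> d \<star>\<close>; for \<open>n = 2\<close> the sign is always negative.
\<close>

definition codiff1 :: "metric \<Rightarrow> form1 \<Rightarrow> form0" where
  "codiff1 g w p = - star2 g (ext_d1 (star1 g w)) p"

definition codiff2 :: "metric \<Rightarrow> form2 \<Rightarrow> form1" where
  "codiff2 g \<eta> p v = - star1 g (ext_d0 (star2 g \<eta>)) p v"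

definition hodge_laplacian1 :: "metric \<Rightarrow> form1 \<Rightarrow> form1" where
  "hodge_laplacian1 g w p v = ext_d0 (codiff1 g w) p v + codiff2 g (ext_d1 w) p v"

definition upper_half_plane :: "point set" where
  "upper_half_plane = {(x, y). y > 0}"

definition hyp_metric :: metric where
  "hyp_metric p u v = (dx u * dx v + dy u * dy v) / (snd p)\<^sup>2"

definition partial_x :: "(real \<times> real \<Rightarrow> real) \<Rightarrow> real \<times> real \<Rightarrow> real" where
  "partial_x f = (\<lambda>(x, y). deriv (\<lambda>s. f (s, y)) x)"

definition partial_y :: "(real \<times> real \<Rightarrow> real) \<Rightarrow> real \<times> real \<Rightarrow> real" where
  "partial_y f = (\<lambda>(x, y). deriv (\<lambda>t. f (x, t)) y)"

end

theory Submission
  imports Defs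
begin

text \<open>
  In dimension two the Hodge star on 1-forms depends only on the conformal class of the metric,
  so for the hyperbolic metric it is the Euclidean rotation \<open>dx \<mapsto> dy\<close>,
  \<open>dy \<mapsto> - dx\<close>. The metric enters only through the area form \<open>dx \<and> dy / y\<^sup>2\<close>, that
  is, through the factor \<open>y\<^sup>2\<close> in the star on 2-forms. Hence, for
  \<open>w = w\<^sub>1 dx + w\<^sub>2 dy\<close>,
  \<open>\<delta>w = - y\<^sup>2 (\<partial>\<^sub>x w\<^sub>1 + \<partial>\<^sub>y w\<^sub>2)\<close> (\<open>codiff1_hyp\<close>), and the codifferential of
  \<open>c dx \<and> dy\<close> is \<open>\<partial>\<^sub>y (y\<^sup>2 c) dx - \<partial>\<^sub>x (y\<^sup>2 c) dy\<close> (\<open>codiff2_hyp\<close>), to be applied to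
  \<open>c = \<partial>\<^sub>x w\<^sub>2 - \<partial>\<^sub>y w\<^sub>1\<close>. The first-order terms of the Laplacian arise when
  \<open>\<partial>\<^sub>y\<close> hits the factor \<open>y\<^sup>2\<close>. Among the second-order terms the mixed derivatives in
  \<open>d\<delta>w\<close> and \<open>\<delta>dw\<close> cancel because second derivatives commute; this symmetry is
  \<open>frechet_derivative_commute\<close>.
\<close>

section \<open>Symmetry of second derivatives\<close>

text \<open>
  The mean value theorem along \<open>u\<close> turns the second difference into \<open>t\<close> times an increment of
  the derivative in direction \<open>u\<close> between two points whose difference is \<open>t v\<close> and which both
  lie at distance \<open>O(t)\<close> from \<open>p\<close>. Differentiability of that derivative at the single point
  \<open>p\<close> then suffices for the limit.
\<close>

lemma second_difference_quotient_tendsto: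
  fixes f :: "'a::real_normed_vector \<Rightarrow> real"
  assumes S: "open S" "p \<in> S"
    and f: "\<And>q. q \<in> S \<Longrightarrow> (f has_derivative D q) (at q)"
    and A: "((\<lambda>q. D q u) has_derivative A) (at p)"
  shows "((\<lambda>t. (f (p + t *\<^sub>R u + t *\<^sub>R v) - f (p + t *\<^sub>R u) - f (p + t *\<^sub>R v) + f p) / t\<^sup>2)
           \<longlongrightarrow> A v) (at_right 0)"
proof (rule tendstoI)
  fix e :: real assume e: "e > 0"
  define N where "N = norm u + norm v + 1"
  have N: "N > 0" unfolding N_def by (smt (verit) norm_ge_zero)
  \<comment> \<open>two remainders, each at most \<open>c\<close> times \<open>t N\<close>, must stay below \<open>e t\<close> in total\<close>
  define c where "c = e / (4 * N)"
  have c: "c > 0" using e N by (simp add: c_def)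
  interpret A: bounded_linear A using A by (rule has_derivative_bounded_linear)
  obtain d where d: "d > 0"
    and rem: "\<And>q. norm (q - p) < d \<Longrightarrow> \<bar>D q u - D p u - A (q - p)\<bar> \<le> c * norm (q - p)"
    using A c unfolding has_derivative_at_alt by (auto simp: real_norm_def)
  obtain r where r: "r > 0" "ball p r \<subseteq> S"
    using S open_contains_ball by blast
  define m where "m = min d r / N"
  have m: "m > 0" using d r N by (simp add: m_def)
  have near: "norm (s *\<^sub>R u + t' *\<^sub>R v) \<le> t * N"
    if "0 \<le> s" "s \<le> t" "0 \<le> t'" "t' \<le> t" for s t t' :: real
  proof -
    have "norm (s *\<^sub>R u + t' *\<^sub>R v) \<le> s * norm u + t' * norm v"
      using norm_triangle_ineq[of "s *\<^sub>R u" "t' *\<^sub>R v"] that by simp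
    also have "\<dots> \<le> t * norm u + t * norm v"
      using that by (intro add_mono mult_right_mono) auto
    also have "\<dots> \<le> t * N" using that by (simp add: N_def algebra_simps)
    finally show ?thesis .
  qed
  have "dist ((f (p + t *\<^sub>R u + t *\<^sub>R v) - f (p + t *\<^sub>R u) - f (p + t *\<^sub>R v) + f p) / t\<^sup>2) (A v) < e"
    if t: "0 < t" "t < m" for t
  proof -
    have tN: "t * N < d" "t * N < r"
      using t N by (auto simp: m_def pos_less_divide_eq)
    have inS: "p + s *\<^sub>R u + t' *\<^sub>R v \<in> S" if "0 \<le> s" "s \<le> t" "0 \<le> t'" "t' \<le> t" for s t'
    proof -
      have "dist p (p + s *\<^sub>R u + t' *\<^sub>R v) = norm (s *\<^sub>R u + t' *\<^sub>R v)"
        by (metis add.assoc add_diff_cancel_left' dist_commute dist_norm)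
      then show ?thesis using near[OF that] tN r by auto
    qed
    \<comment> \<open>the summand \<open>0 *\<^sub>R v\<close> makes both terms, and later both remainders, instances of one formula\<close>
    define \<phi> where "\<phi> s = f (p + s *\<^sub>R u + t *\<^sub>R v) - f (p + s *\<^sub>R u + 0 *\<^sub>R v)" for s
    have comp: "((\<lambda>s. f (p + s *\<^sub>R u + t' *\<^sub>R v)) has_derivative
                  (\<lambda>h. D (p + s *\<^sub>R u + t' *\<^sub>R v) (h *\<^sub>R u))) (at s)"
      if "0 \<le> s" "s \<le> t" "0 \<le> t'" "t' \<le> t" for s t'
      by (rule has_derivative_compose[where f = "\<lambda>s. p + s *\<^sub>R u + t' *\<^sub>R v",
            OF _ f[OF inS[OF that]]])
         (auto intro!: derivative_eq_intros)
    have scale: "D q (h *\<^sub>R u) = h * D q u" if "q \<in> S" for q h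
      using linear_scale[OF has_derivative_linear[OF f[OF that]]] by simp
    have \<phi>': "(\<phi> has_derivative (\<lambda>h. h * (D (p + s *\<^sub>R u + t *\<^sub>R v) u - D (p + s *\<^sub>R u + 0 *\<^sub>R v) u)))
            (at s)" if "0 \<le> s" "s \<le> t" for s
      unfolding \<phi>_def
      using has_derivative_diff[OF comp[OF that, of t] comp[OF that, of 0]] t
      by (simp only: scale inS that right_diff_distrib order_refl less_imp_le)
    obtain s where s: "0 < s" "s < t"
      and mvt: "\<phi> t - \<phi> 0 = t * (D (p + s *\<^sub>R u + t *\<^sub>R v) u - D (p + s *\<^sub>R u + 0 *\<^sub>R v) u)"
      using mvt_simple[OF t(1) has_derivative_at_withinI[OF \<phi>']] by auto
    have rem': "\<bar>D (p + s *\<^sub>R u + t' *\<^sub>R v) u - D p u - (s * A u + t' * A v)\<bar> \<le> c * (t * N)"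
      if "0 \<le> t'" "t' \<le> t" for t'
    proof -
      have n: "norm (s *\<^sub>R u + t' *\<^sub>R v) \<le> t * N" using near s that by simp
      have "\<bar>D (p + s *\<^sub>R u + t' *\<^sub>R v) u - D p u - (s * A u + t' * A v)\<bar>
              \<le> c * norm (s *\<^sub>R u + t' *\<^sub>R v)"
        using rem[of "p + s *\<^sub>R u + t' *\<^sub>R v"] n tN by (simp add: add.assoc A.add A.scaleR)
      also have "\<dots> \<le> c * (t * N)" using n c by simp
      finally show ?thesis .
    qed
    define E where "E = D (p + s *\<^sub>R u + t *\<^sub>R v) u - D (p + s *\<^sub>R u + 0 *\<^sub>R v) u - t * A v"
    have "\<bar>E\<bar> \<le> 2 * (c * (t * N))"
      using rem'[of t] rem'[of 0] t unfolding E_def by (smt (verit) mult_zero_left)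
    also have "\<dots> = t * (e / 2)" using N by (simp add: c_def)
    also have "\<dots> < t * e" using t e by simp
    finally have E: "\<bar>E\<bar> < t * e" .
    have "f (p + t *\<^sub>R u + t *\<^sub>R v) - f (p + t *\<^sub>R u) - f (p + t *\<^sub>R v) + f p = t * (t * A v + E)"
      using mvt unfolding \<phi>_def E_def by simp
    then have "(f (p + t *\<^sub>R u + t *\<^sub>R v) - f (p + t *\<^sub>R u) - f (p + t *\<^sub>R v) + f p) / t\<^sup>2 = A v + E / t"
      using t by (simp add: field_simps power2_eq_square)
    moreover have "\<bar>E / t\<bar> < e" using E t by (simp add: pos_divide_less_eq mult.commute)
    ultimately show ?thesis by (simp add: dist_real_def)
  qed
  then show "\<forall>\<^sub>F t in at_right 0.
      dist ((f (p + t *\<^sub>R u + t *\<^sub>R v) - f (p + t *\<^sub>R u) - f (p + t *\<^sub>R v) + f p) / t\<^sup>2) (A v) < e"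
    unfolding eventually_at_right_field using m by blast
qed

text \<open>
  The second difference is symmetric in \<open>u\<close> and \<open>v\<close>, so both iterated derivatives are limits of
  the same quotient. This is Young's form of the Schwarz theorem: continuity of the second
  derivatives is replaced by differentiability of the first derivatives at the point.
\<close>

lemma frechet_derivative_commute:
  fixes f :: "'a::real_normed_vector \<Rightarrow> real"
  assumes S: "open S" "p \<in> S"
    and f: "\<And>q. q \<in> S \<Longrightarrow> f differentiable (at q)"
    and u: "(\<lambda>q. frechet_derivative f (at q) u) differentiable (at p)"
    and v: "(\<lambda>q. frechet_derivative f (at q) v) differentiable (at p)"
  shows "frechet_derivative (\<lambda>q. frechet_derivative f (at q) u) (at p) v
       = frechet_derivative (\<lambda>q. frechet_derivative f (at q) v) (at p) u"
proof -
  have D: "\<And>q. q \<in> S \<Longrightarrow> (f has_derivative frechet_derivative f (at q)) (at q)"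
    using f frechet_derivative_works by blast
  note U = second_difference_quotient_tendsto[OF S D u[unfolded frechet_derivative_works], of v]
  note V = second_difference_quotient_tendsto[OF S D v[unfolded frechet_derivative_works], of u]
  have "(\<lambda>t. (f (p + t *\<^sub>R v + t *\<^sub>R u) - f (p + t *\<^sub>R v) - f (p + t *\<^sub>R u) + f p) / t\<^sup>2)
      = (\<lambda>t. (f (p + t *\<^sub>R u + t *\<^sub>R v) - f (p + t *\<^sub>R u) - f (p + t *\<^sub>R v) + f p) / t\<^sup>2)"
    by (simp add: algebra_simps)
  with U V show ?thesis
    by (intro tendsto_unique[OF trivial_limit_at_right_real[of 0]]) auto
qed

section \<open>Coordinate expressions in the plane\<close>

lemma linear_coordinates:
  fixes \<alpha> :: covec
  assumes "linear \<alpha>"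
  shows "\<alpha> = (\<lambda>v. \<alpha> (1, 0) * dx v + \<alpha> (0, 1) * dy v)"
proof
  fix v :: vec
  have "\<alpha> v = \<alpha> (fst v *\<^sub>R (1, 0) + snd v *\<^sub>R (0, 1))" by simp
  also have "\<dots> = \<alpha> (1, 0) * dx v + \<alpha> (0, 1) * dy v"
    unfolding linear_add[OF assms] linear_scale[OF assms] by (simp add: dx_def dy_def)
  finally show "\<alpha> v = \<alpha> (1, 0) * dx v + \<alpha> (0, 1) * dy v" .
qed

lemma linear_covec: "linear (\<lambda>v. a * dx v + b * dy v)"
  by (rule linearI) (auto simp: dx_def dy_def algebra_simps)

lemma partial_x_eq_frechet:
  assumes "f differentiable (at p)"
  shows "partial_x f p = frechet_derivative f (at p) (1, 0)"
proof -
  obtain x y where p: "p = (x, y)" by fastforce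
  have f: "(f has_derivative frechet_derivative f (at p)) (at (x, y))"
    using assms frechet_derivative_works p by blast
  have "((\<lambda>s. f (s, y)) has_derivative (\<lambda>h. frechet_derivative f (at p) (h, 0))) (at x)"
    by (rule has_derivative_compose[where f = "\<lambda>s. (s, y)", OF _ f]) (auto intro!: derivative_eq_intros)
  moreover have "(\<lambda>h. frechet_derivative f (at p) (h, 0)) = (*) (frechet_derivative f (at p) (1, 0))"
  proof
    show "frechet_derivative f (at p) (h, 0) = frechet_derivative f (at p) (1, 0) * h" for h
      using linear_scale[OF has_derivative_linear[OF f], of h "(1, 0)"] by (simp add: mult.commute)
  qed
  ultimately have "((\<lambda>s. f (s, y)) has_field_derivative frechet_derivative f (at p) (1, 0)) (at x)"
    by (simp only: has_field_derivative_def)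
  then show ?thesis by (simp add: partial_x_def p DERIV_imp_deriv)
qed

lemma partial_y_eq_frechet:
  assumes "f differentiable (at p)"
  shows "partial_y f p = frechet_derivative f (at p) (0, 1)"
proof -
  obtain x y where p: "p = (x, y)" by fastforce
  have f: "(f has_derivative frechet_derivative f (at p)) (at (x, y))"
    using assms frechet_derivative_works p by blast
  have "((\<lambda>t. f (x, t)) has_derivative (\<lambda>h. frechet_derivative f (at p) (0, h))) (at y)"
    by (rule has_derivative_compose[where f = "\<lambda>t. (x, t)", OF _ f]) (auto intro!: derivative_eq_intros)
  moreover have "(\<lambda>h. frechet_derivative f (at p) (0, h)) = (*) (frechet_derivative f (at p) (0, 1))"
  proof
    show "frechet_derivative f (at p) (0, h) = frechet_derivative f (at p) (0, 1) * h" for h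
      using linear_scale[OF has_derivative_linear[OF f], of h "(0, 1)"] by (simp add: mult.commute)
  qed
  ultimately have "((\<lambda>t. f (x, t)) has_field_derivative frechet_derivative f (at p) (0, 1)) (at y)"
    by (simp only: has_field_derivative_def)
  then show ?thesis by (simp add: partial_y_def p DERIV_imp_deriv)
qed

lemma has_derivative_partials:
  assumes "f differentiable (at p)"
  shows "(f has_derivative (\<lambda>v. partial_x f p * dx v + partial_y f p * dy v)) (at p)"
proof -
  have "(f has_derivative frechet_derivative f (at p)) (at p)"
    using assms frechet_derivative_works by blast
  then show ?thesis
    unfolding partial_x_eq_frechet[OF assms] partial_y_eq_frechet[OF assms]
    using linear_coordinates[OF linear_frechet_derivative[OF assms]] by simp
qed

lemma partials_eqI:
  assumes "(f has_derivative (\<lambda>v. a * dx v + b * dy v)) (at p)"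
  shows "partial_x f p = a" "partial_y f p = b"
proof -
  have "f differentiable (at p)" using assms unfolding differentiable_def by blast
  then show "partial_x f p = a" "partial_y f p = b"
    by (simp_all add: partial_x_eq_frechet partial_y_eq_frechet
        frechet_derivative_at[OF assms, symmetric] dx_def dy_def)
qed

lemma ext_d0_eqI:
  assumes "open S" "p \<in> S" "\<And>q. q \<in> S \<Longrightarrow> f q = g q"
    and "(g has_derivative g') (at p)"
  shows "ext_d0 f p = g'"
proof -
  have "(f has_derivative g') (at p)"
    using has_derivative_transform_within_open[OF assms(4,1,2)] assms(3) by simp
  then show ?thesis by (simp add: ext_d0_def fun_eq_iff frechet_derivative_at[symmetric])
qed

lemma ext_d1_coordinates:
  assumes S: "open S" "p \<in> S"
    and w: "\<And>q. q \<in> S \<Longrightarrow> w q = (\<lambda>v. a q * dx v + b q * dy v)"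
    and a: "a differentiable (at p)" and b: "b differentiable (at p)"
  shows "ext_d1 w p = (\<lambda>u v. (partial_x b p - partial_y a p) * wedge dx dy u v)"
proof (intro ext)
  fix u v
  have D: "frechet_derivative (\<lambda>q. w q v) (at p) =
      (\<lambda>h. (partial_x a p * dx h + partial_y a p * dy h) * dx v
         + (partial_x b p * dx h + partial_y b p * dy h) * dy v)" for v
  proof -
    have "((\<lambda>q. a q * dx v + b q * dy v) has_derivative
        (\<lambda>h. (partial_x a p * dx h + partial_y a p * dy h) * dx v
           + (partial_x b p * dx h + partial_y b p * dy h) * dy v)) (at p)"
      by (intro has_derivative_add has_derivative_mult_left has_derivative_partials a b)
    from ext_d0_eqI[OF S _ this, of "\<lambda>q. w q v"] show ?thesis
      using w by (simp add: ext_d0_def fun_eq_iff)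
  qed
  show "ext_d1 w p u v = (partial_x b p - partial_y a p) * wedge dx dy u v"
    unfolding ext_d1_def D wedge_def by (simp add: algebra_simps)
qed

text \<open>
  Coefficient functions of a form are determined only on the domain of the form, whereas
  smoothness is known for its evaluations at fixed vectors; this transfers it from one to the
  other. Openness matters: it makes the ambient derivatives depend only on the values inside the domain.
\<close>

lemma Ck_on_cong:
  assumes S: "open S" and "\<And>p. p \<in> S \<Longrightarrow> f p = g p" and "Ck_on k S f"
  shows "Ck_on k S g"
  using assms(2,3)
proof (induction k arbitrary: f g)
  case 0
  then show ?case using continuous_on_cong by auto
next
  case (Suc k)
  have f: "f differentiable (at p)" if "p \<in> S" for p using Suc.prems that by simp
  have D: "(g has_derivative frechet_derivative f (at p)) (at p)" if "p \<in> S" for p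
    using has_derivative_transform_within_open[OF f[OF that, unfolded frechet_derivative_works]
        S that] Suc.prems(1) by blast
  then have "frechet_derivative f (at p) v = frechet_derivative g (at p) v" if "p \<in> S" for p v
    using frechet_derivative_at[OF D[OF that]] by simp
  then have "Ck_on k S (\<lambda>p. frechet_derivative g (at p) v)" for v
    using Suc.IH[of "\<lambda>p. frechet_derivative f (at p) v" "\<lambda>p. frechet_derivative g (at p) v"]
      Suc.prems(2) by simp
  moreover have "g differentiable (at p)" if "p \<in> S" for p
    using D[OF that] unfolding differentiable_def by blast
  ultimately show ?case by simp
qed

lemma smooth_on_partials_differentiable:
  assumes S: "open S" "p \<in> S" and f: "smooth_on S f"
  shows "f differentiable (at p)" "partial_x f differentiable (at p)"
    "partial_y f differentiable (at p)"
    and "partial_y (partial_x f) p = partial_x (partial_y f) p"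
proof -
  have C2: "Ck_on (Suc (Suc 0)) S f" using f unfolding smooth_on_def by blast
  have f1: "f differentiable (at q)" if "q \<in> S" for q using C2 that by simp
  have f2: "(\<lambda>q. frechet_derivative f (at q) v) differentiable (at p)" for v
    using C2 S unfolding Ck_on.simps by blast
  have X: "((\<lambda>q. frechet_derivative f (at q) (1, 0)) has_derivative F) (at p)
      \<Longrightarrow> (partial_x f has_derivative F) (at p)" for F
    by (erule has_derivative_transform_within_open[OF _ S]) (simp add: f1 partial_x_eq_frechet)
  have Y: "((\<lambda>q. frechet_derivative f (at q) (0, 1)) has_derivative F) (at p)
      \<Longrightarrow> (partial_y f has_derivative F) (at p)" for F
    by (erule has_derivative_transform_within_open[OF _ S]) (simp add: f1 partial_y_eq_frechet)
  note X' = X[OF f2[unfolded frechet_derivative_works]]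
  note Y' = Y[OF f2[unfolded frechet_derivative_works]]
  show "f differentiable (at p)" using f1 S by simp
  show dX: "partial_x f differentiable (at p)" using X' unfolding differentiable_def by blast
  show dY: "partial_y f differentiable (at p)" using Y' unfolding differentiable_def by blast
  show "partial_y (partial_x f) p = partial_x (partial_y f) p"
    unfolding partial_x_eq_frechet[OF dY] partial_y_eq_frechet[OF dX]
      frechet_derivative_at[OF X', symmetric] frechet_derivative_at[OF Y', symmetric]
    by (rule frechet_derivative_commute[OF S f1 f2 f2])
qed

section \<open>The Hodge star of the hyperbolic metric\<close>

lemma open_upper_half_plane: "open upper_half_plane"
proof -
  have "upper_half_plane = UNIV \<times> {0<..}" by (auto simp: upper_half_plane_def)
  then show ?thesis using open_Times[OF open_UNIV open_greaterThan] by metis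
qed

lemma sharp_hyp:
  assumes "snd p > 0" and "linear \<alpha>"
  shows "sharp hyp_metric p \<alpha> = ((snd p)\<^sup>2 * \<alpha> (1, 0), (snd p)\<^sup>2 * \<alpha> (0, 1))"
  unfolding sharp_def
proof (rule the_equality)
  show "\<forall>v. hyp_metric p ((snd p)\<^sup>2 * \<alpha> (1, 0), (snd p)\<^sup>2 * \<alpha> (0, 1)) v = \<alpha> v"
  proof
    fix v
    have "hyp_metric p ((snd p)\<^sup>2 * \<alpha> (1, 0), (snd p)\<^sup>2 * \<alpha> (0, 1)) v
        = \<alpha> (1, 0) * dx v + \<alpha> (0, 1) * dy v"
      using assms(1) by (simp add: hyp_metric_def dx_def dy_def field_simps)
    then show "hyp_metric p ((snd p)\<^sup>2 * \<alpha> (1, 0), (snd p)\<^sup>2 * \<alpha> (0, 1)) v = \<alpha> v"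
      using fun_cong[OF linear_coordinates[OF assms(2)], of v] by simp
  qed
next
  fix u assume u: "\<forall>v. hyp_metric p u v = \<alpha> v"
  show "u = ((snd p)\<^sup>2 * \<alpha> (1, 0), (snd p)\<^sup>2 * \<alpha> (0, 1))"
    using u[rule_format, of "(1, 0)"] u[rule_format, of "(0, 1)"] assms(1)
    by (auto simp: hyp_metric_def dx_def dy_def prod_eq_iff field_simps)
qed

lemma covec_inner_hyp:
  assumes "snd p > 0" and "linear \<alpha>" "linear \<beta>"
  shows "covec_inner hyp_metric p \<alpha> \<beta>
       = (snd p)\<^sup>2 * (\<alpha> (1, 0) * \<beta> (1, 0) + \<alpha> (0, 1) * \<beta> (0, 1))"
proof -
  have "snd p \<noteq> 0" using assms(1) by simp
  then show ?thesis
    by (simp add: covec_inner_def sharp_hyp assms hyp_metric_def dx_def dy_def divide_simps)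
       (simp add: algebra_simps power2_eq_square)
qed

lemma vol_hyp:
  assumes "snd p > 0"
  shows "vol hyp_metric p = (\<lambda>u v. wedge dx dy u v / (snd p)\<^sup>2)"
proof -
  have "sqrt (1 / (snd p)\<^sup>2 * (1 / (snd p)\<^sup>2)) = inverse ((snd p)\<^sup>2)"
    by (metis inverse_eq_divide real_sqrt_abs2 abs_of_nonneg zero_le_divide_1_iff zero_le_power2)
  then show ?thesis
    by (simp add: fun_eq_iff vol_def hyp_metric_def dx_def dy_def field_class.field_divide_inverse
        mult.commute)
qed

text \<open>
  The inner product on covectors carries the factor \<open>y\<^sup>2\<close> and the area form the factor
  \<open>1 / y\<^sup>2\<close>; they cancel, and the Euclidean rotation remains.
\<close>

lemma star1_hyp:
  assumes p: "snd p > 0" and w: "w p = (\<lambda>v. a * dx v + b * dy v)"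
  shows "star1 hyp_metric w p = (\<lambda>v. - b * dx v + a * dy v)"
  unfolding star1_def
proof (rule the_equality)
  have lin: "linear (w p)" unfolding w by (rule linear_covec)
  have R: "covec_inner hyp_metric p \<alpha> (w p) * vol hyp_metric p u v
      = (\<alpha> (1, 0) * a + \<alpha> (0, 1) * b) * wedge dx dy u v" if "linear \<alpha>" for \<alpha> u v
    using p by (simp add: covec_inner_hyp[OF p that lin] vol_hyp[OF p])
      (simp add: w dx_def dy_def)
  have "wedge \<alpha> (\<lambda>v. - b * dx v + a * dy v)
      = (\<lambda>u v. covec_inner hyp_metric p \<alpha> (w p) * vol hyp_metric p u v)" if "linear \<alpha>" for \<alpha>
  proof (intro ext)
    fix u v
    show "wedge \<alpha> (\<lambda>v. - b * dx v + a * dy v) u v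
        = covec_inner hyp_metric p \<alpha> (w p) * vol hyp_metric p u v"
      unfolding R[OF that] wedge_def
        fun_cong[OF linear_coordinates[OF that], of u] fun_cong[OF linear_coordinates[OF that], of v]
      by (simp add: algebra_simps)
  qed
  then show "linear (\<lambda>v. - b * dx v + a * dy v) \<and> (\<forall>\<alpha>. linear \<alpha> \<longrightarrow>
      wedge \<alpha> (\<lambda>v. - b * dx v + a * dy v)
        = (\<lambda>u v. covec_inner hyp_metric p \<alpha> (w p) * vol hyp_metric p u v))"
    using linear_covec by blast
  fix \<gamma> :: covec
  assume \<gamma>: "linear \<gamma> \<and> (\<forall>\<alpha>. linear \<alpha> \<longrightarrow>
      wedge \<alpha> \<gamma> = (\<lambda>u v. covec_inner hyp_metric p \<alpha> (w p) * vol hyp_metric p u v))"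
  then have W: "wedge \<alpha> \<gamma> (1, 0) (0, 1) = \<alpha> (1, 0) * a + \<alpha> (0, 1) * b" if "linear \<alpha>" for \<alpha>
    using R[OF that] that by (simp add: wedge_def dx_def dy_def)
  have lins: "linear dx" "linear dy"
    using linear_covec[of 1 0] linear_covec[of 0 1] by (simp_all add: eta_contract_eq)
  \<comment> \<open>testing against \<open>dx\<close> and \<open>dy\<close> reads off the two coefficients of \<open>\<gamma>\<close>\<close>
  have "\<gamma> (0, 1) = a" "\<gamma> (1, 0) = - b"
    using W[OF lins(1)] W[OF lins(2)] by (auto simp: wedge_def dx_def dy_def)
  then show "\<gamma> = (\<lambda>v. - b * dx v + a * dy v)"
    using linear_coordinates[of \<gamma>] \<gamma> by simp
qed

lemma star2_hyp:
  assumes p: "snd p > 0" and \<eta>: "\<eta> p = (\<lambda>u v. c * wedge dx dy u v)"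
  shows "star2 hyp_metric \<eta> p = (snd p)\<^sup>2 * c"
  unfolding star2_def
proof (rule the_equality)
  show "\<eta> p = (\<lambda>u v. (snd p)\<^sup>2 * c * vol hyp_metric p u v)"
    using p by (simp add: \<eta> vol_hyp)
  fix k assume "\<eta> p = (\<lambda>u v. k * vol hyp_metric p u v)"
  from fun_cong[OF fun_cong[OF this, of "(1, 0)"], of "(0, 1)"]
  show "k = (snd p)\<^sup>2 * c"
    using p by (simp add: \<eta> vol_hyp wedge_def dx_def dy_def field_simps)
qed

section \<open>Codifferentials and the Hodge Laplacian\<close>

lemma codiff1_hyp:
  assumes p: "p \<in> upper_half_plane"
    and w: "\<And>q. q \<in> upper_half_plane \<Longrightarrow> w q = (\<lambda>v. a q * dx v + b q * dy v)"
    and a: "a differentiable (at p)" and b: "b differentiable (at p)"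
  shows "codiff1 hyp_metric w p = - ((snd p)\<^sup>2 * (partial_x a p + partial_y b p))"
proof -
  have "star1 hyp_metric w q = (\<lambda>v. - b q * dx v + a q * dy v)" if "q \<in> upper_half_plane" for q
    using that by (intro star1_hyp w) (auto simp: upper_half_plane_def)
  moreover have "(\<lambda>q. - b q) differentiable (at p)" using b by (rule differentiable_minus)
  moreover have "partial_y (\<lambda>q. - b q) p = - partial_y b p"
    using has_derivative_minus[OF has_derivative_partials[OF b]]
    by (intro partials_eqI(2)[where a = "- partial_x b p"]) (simp add: algebra_simps)
  ultimately have "ext_d1 (star1 hyp_metric w) p
      = (\<lambda>u v. (partial_x a p + partial_y b p) * wedge dx dy u v)"
    using ext_d1_coordinates[OF open_upper_half_plane p _ _ a,
        of "star1 hyp_metric w" "\<lambda>q. - b q"] by simp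
  then show ?thesis
    using p by (simp add: codiff1_def upper_half_plane_def split_beta star2_hyp)
qed

lemma has_derivative_snd_power2_mult:
  fixes c :: form0
  assumes "c differentiable (at p)"
  shows "((\<lambda>q. (snd q)\<^sup>2 * c q) has_derivative
    (\<lambda>v. ((snd p)\<^sup>2 * partial_x c p) * dx v
       + (2 * snd p * c p + (snd p)\<^sup>2 * partial_y c p) * dy v)) (at p)"
  by (rule derivative_eq_intros has_derivative_partials[OF assms] refl)+
     (auto simp: fun_eq_iff dx_def dy_def algebra_simps power2_eq_square)

lemma codiff2_hyp:
  assumes p: "p \<in> upper_half_plane"
    and \<eta>: "\<And>q. q \<in> upper_half_plane \<Longrightarrow> \<eta> q = (\<lambda>u v. c q * wedge dx dy u v)"
    and c: "c differentiable (at p)"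
  shows "codiff2 hyp_metric \<eta> p = (\<lambda>v. (2 * snd p * c p + (snd p)\<^sup>2 * partial_y c p) * dx v
     - ((snd p)\<^sup>2 * partial_x c p) * dy v)"
proof -
  have "star2 hyp_metric \<eta> q = (snd q)\<^sup>2 * c q" if "q \<in> upper_half_plane" for q
    using that by (intro star2_hyp \<eta>) (auto simp: upper_half_plane_def)
  note d = ext_d0_eqI[OF open_upper_half_plane p this has_derivative_snd_power2_mult[OF c]]
  have "snd p > 0" using p by (auto simp: upper_half_plane_def)
  from star1_hyp[of p "ext_d0 (star2 hyp_metric \<eta>)", OF this d] show ?thesis
    by (simp add: codiff2_def fun_eq_iff algebra_simps)
qed

theorem lemma6p1:
  fixes w :: form1 and w1 w2 :: form0
  assumes "w \<in> Omega1 upper_half_plane"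
    and "\<forall>p\<in>upper_half_plane. w p = (\<lambda>v. w1 p * dx v + w2 p * dy v)"
  shows "\<forall>(x, y)\<in>upper_half_plane.
    hodge_laplacian1 hyp_metric w (x, y) = (\<lambda>v.
      (- y\<^sup>2 * partial_x (partial_x w1) (x, y) - y\<^sup>2 * partial_y (partial_y w1) (x, y)
         + 2 * y * partial_x w2 (x, y) - 2 * y * partial_y w1 (x, y)) * dx v
      + (- y\<^sup>2 * partial_x (partial_x w2) (x, y) - y\<^sup>2 * partial_y (partial_y w2) (x, y)
         - 2 * y * partial_x w1 (x, y) - 2 * y * partial_y w2 (x, y)) * dy v)"
proof -
  have smooth: "smooth_on upper_half_plane w1" "smooth_on upper_half_plane w2"
  proof -
    have W: "smooth_on upper_half_plane (\<lambda>p. w p v)" for v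
      using assms(1) unfolding Omega1_def by blast
    have E: "w p (1, 0) = w1 p" "w p (0, 1) = w2 p" if "p \<in> upper_half_plane" for p
      using assms(2) that by (simp_all add: dx_def dy_def)
    show "smooth_on upper_half_plane w1" "smooth_on upper_half_plane w2"
      using W[of "(1, 0)"] W[of "(0, 1)"] Ck_on_cong[OF open_upper_half_plane E(1)]
        Ck_on_cong[OF open_upper_half_plane E(2)]
      unfolding smooth_on_def by simp_all
  qed
  have w: "w q = (\<lambda>v. w1 q * dx v + w2 q * dy v)" if "q \<in> upper_half_plane" for q
    using assms(2) that by simp
  note w1 = smooth_on_partials_differentiable[OF open_upper_half_plane _ smooth(1)]
  note w2 = smooth_on_partials_differentiable[OF open_upper_half_plane _ smooth(2)]
  have main: "hodge_laplacian1 hyp_metric w p = (\<lambda>v.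
      (- (snd p)\<^sup>2 * partial_x (partial_x w1) p - (snd p)\<^sup>2 * partial_y (partial_y w1) p
         + 2 * snd p * partial_x w2 p - 2 * snd p * partial_y w1 p) * dx v
      + (- (snd p)\<^sup>2 * partial_x (partial_x w2) p - (snd p)\<^sup>2 * partial_y (partial_y w2) p
         - 2 * snd p * partial_x w1 p - 2 * snd p * partial_y w2 p) * dy v)"
    if p: "p \<in> upper_half_plane" for p
  proof -
    define diverg where "diverg q = partial_x w1 q + partial_y w2 q" for q
    define curl where "curl q = partial_x w2 q - partial_y w1 q" for q
    note P1 = has_derivative_partials[OF w1(2)[OF p]] has_derivative_partials[OF w1(3)[OF p]]
    note P2 = has_derivative_partials[OF w2(2)[OF p]] has_derivative_partials[OF w2(3)[OF p]]
    have diverg: "(diverg has_derivative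
        (\<lambda>v. (partial_x (partial_x w1) p + partial_x (partial_y w2) p) * dx v
           + (partial_y (partial_x w1) p + partial_y (partial_y w2) p) * dy v)) (at p)"
      using has_derivative_add[OF P1(1) P2(2)] by (simp add: diverg_def[abs_def] algebra_simps)
    have curl: "(curl has_derivative
        (\<lambda>v. (partial_x (partial_x w2) p - partial_x (partial_y w1) p) * dx v
           + (partial_y (partial_x w2) p - partial_y (partial_y w1) p) * dy v)) (at p)"
      using has_derivative_diff[OF P2(1) P1(2)] by (simp add: curl_def[abs_def] algebra_simps)
    have diff: "diverg differentiable (at p)" "curl differentiable (at p)"
      using diverg curl unfolding differentiable_def by blast+
    have "codiff1 hyp_metric w q = - ((snd q)\<^sup>2 * diverg q)" if "q \<in> upper_half_plane" for q
      using codiff1_hyp[OF that w w1(1)[OF that] w2(1)[OF that]] by (simp add: diverg_def)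
    then have d\<delta>: "ext_d0 (codiff1 hyp_metric w) p = (\<lambda>v.
        - ((snd p)\<^sup>2 * partial_x diverg p * dx v
           + (2 * snd p * diverg p + (snd p)\<^sup>2 * partial_y diverg p) * dy v))"
      by (rule ext_d0_eqI[OF open_upper_half_plane p _
            has_derivative_minus[OF has_derivative_snd_power2_mult[OF diff(1)]]])
    have "ext_d1 w q = (\<lambda>u v. curl q * wedge dx dy u v)" if "q \<in> upper_half_plane" for q
      using ext_d1_coordinates[OF open_upper_half_plane that w w1(1)[OF that] w2(1)[OF that]]
      by (simp add: curl_def)
    then have \<delta>d: "codiff2 hyp_metric (ext_d1 w) p = (\<lambda>v.
        (2 * snd p * curl p + (snd p)\<^sup>2 * partial_y curl p) * dx v
          - (snd p)\<^sup>2 * partial_x curl p * dy v)"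
      by (rule codiff2_hyp[OF p _ diff(2)])
    \<comment> \<open>with the mixed derivatives rewritten to a common order they cancel\<close>
    show ?thesis
      unfolding fun_eq_iff hodge_laplacian1_def d\<delta> \<delta>d partials_eqI[OF diverg] partials_eqI[OF curl]
        w1(4)[OF p] w2(4)[OF p]
      by (simp add: diverg_def curl_def algebra_simps)
  qed
  show ?thesis
  proof (rule ballI)
    fix p assume "p \<in> upper_half_plane"
    from main[OF this] show "case p of (x, y) \<Rightarrow> hodge_laplacian1 hyp_metric w (x, y) = (\<lambda>v.
      (- y\<^sup>2 * partial_x (partial_x w1) (x, y) - y\<^sup>2 * partial_y (partial_y w1) (x, y)
         + 2 * y * partial_x w2 (x, y) - 2 * y * partial_y w1 (x, y)) * dx v
      + (- y\<^sup>2 * partial_x (partial_x w2) (x, y) - y\<^sup>2 * partial_y (partial_y w2) (x, y)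
         - 2 * y * partial_x w1 (x, y) - 2 * y * partial_y w2 (x, y)) * dy v)"
      by (cases p) simp
  qed
qed

end
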